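(* Let $R$ be a commutative ring with unity, let $\mathcal{A}$ be a commutative unital $R$-algebra, and let $\sigma,\tau$ be two different non-zero unital $R$-algebra endomorphisms of $\mathcal{A}$. Suppose that, as an $R$-module, $\mathcal{A}$ is of finite rank $n$ and has an $R$-basis of the form $\{1,\alpha,\alpha^{2},\dots,\alpha^{n-1}\}$ for some $\alpha\in\mathcal{A}$. Then a $(\sigma,\tau)$-derivation $D:\mathcal{A}\to\mathcal{A}$ is inner if and only if there exists some $\beta\in\mathcal{A}$ such that $D(\alpha)=\beta(\tau-\sigma)(\alpha)$.
   Context: A $(\sigma,\tau)$-derivation of $\mathcal{A}$ is an $R$-linear map $D:\mathcal{A}\to\mathcal{A}$ with $D(xy)=D(x)\tau(y)+\sigma(x)D(y)$ for all $x,y\in\mathcal{A}$. It is called inner if there exists $\beta\in\mathcal{A}$ with $D(x)=\beta\tau(x)-\sigma(x)\beta$ for all $x\in\mathcal{A}$. Here $(\tau-\sigma)(x)=\tau(x)-\sigma(x)$. *)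

theory Defs
  imports Complex_Main
begin

text \<open>
  The type class \<open>comm_ring_1\<close> includes \<open>0 \<noteq> 1\<close>. Nothing is lost for statements about two different
  unital endomorphisms of an algebra: such an algebra, and hence its base ring, is non-zero.
\<close>

locale comm_algebra = module scale
  for scale :: "'r::comm_ring_1 \<Rightarrow> 'a::comm_ring_1 \<Rightarrow> 'a" +
  assumes scale_mult_left: "scale r (x * y) = scale r x * y"

definition algebra_endomorphism ::
    "('r::comm_ring_1 \<Rightarrow> 'a::comm_ring_1 \<Rightarrow> 'a) \<Rightarrow> ('a \<Rightarrow> 'a) \<Rightarrow> bool" where
  "algebra_endomorphism scale f \<longleftrightarrow>
     module_hom scale scale f \<and> (\<forall>x y. f (x * y) = f x * f y) \<and> f 1 = 1"

definition module_basis ::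
    "('r::comm_ring_1 \<Rightarrow> 'a::ab_group_add \<Rightarrow> 'a) \<Rightarrow> 'a set \<Rightarrow> bool" where
  "module_basis scale B \<longleftrightarrow> \<not> module.dependent scale B \<and> module.span scale B = UNIV"

text \<open>Bases over a non-zero commutative ring have equal cardinality, so \<open>n\<close> is determined.\<close>

definition has_finite_rank ::
    "('r::comm_ring_1 \<Rightarrow> 'a::ab_group_add \<Rightarrow> 'a) \<Rightarrow> nat \<Rightarrow> bool" where
  "has_finite_rank scale n \<longleftrightarrow> (\<exists>B. module_basis scale B \<and> finite B \<and> card B = n)"

definition twisted_derivation ::
    "('r::comm_ring_1 \<Rightarrow> 'a::comm_ring_1 \<Rightarrow> 'a) \<Rightarrow> ('a \<Rightarrow> 'a) \<Rightarrow> ('a \<Rightarrow> 'a) \<Rightarrow> ('a \<Rightarrow> 'a) \<Rightarrow> bool" where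
  "twisted_derivation scale \<sigma> \<tau> D \<longleftrightarrow>
     module_hom scale scale D \<and> (\<forall>x y. D (x * y) = D x * \<tau> y + \<sigma> x * D y)"

definition inner_twisted ::
    "('a::comm_ring_1 \<Rightarrow> 'a) \<Rightarrow> ('a \<Rightarrow> 'a) \<Rightarrow> ('a \<Rightarrow> 'a) \<Rightarrow> bool" where
  "inner_twisted \<sigma> \<tau> D \<longleftrightarrow> (\<exists>\<beta>. \<forall>x. D x = \<beta> * \<tau> x - \<sigma> x * \<beta>)"

end

theory Submission
  imports Defs
begin

text \<open>
  For every \<open>\<beta>\<close>, the map \<open>x \<mapsto> \<beta> \<tau>(x) - \<sigma>(x) \<beta>\<close> is itself a \<open>(\<sigma>, \<tau>)\<close>-derivation.
  A \<open>(\<sigma>, \<tau>)\<close>-derivation kills \<open>1\<close> and is determined by its value at \<open>\<alpha>\<close> on all powers of \<open>\<alpha>\<close>,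
  hence on their span, which is the whole algebra.
\<close>

text \<open>In the Leibniz rule the two cross terms \<open>\<sigma> x * \<beta> * \<tau> y\<close>
  cancel, leaving \<open>\<beta> * \<tau> x * \<tau> y - \<sigma> x * \<sigma> y * \<beta>\<close>,
  which multiplicativity of \<sigma> and \<tau> turns into the value at
  \<open>x * y\<close>.\<close>

lemma twisted_derivation_inner:
  assumes "comm_algebra scale"
    and \<sigma>: "algebra_endomorphism scale \<sigma>" and \<tau>: "algebra_endomorphism scale \<tau>"
  shows "twisted_derivation scale \<sigma> \<tau> (\<lambda>x. \<beta> * \<tau> x - \<sigma> x * \<beta>)"
proof -
  interpret comm_algebra scale by fact
  interpret s: module_hom scale scale \<sigma>
    using \<sigma> by (simp add: algebra_endomorphism_def)
  interpret t: module_hom scale scale \<tau>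
    using \<tau> by (simp add: algebra_endomorphism_def)
  \<comment> \<open>Lets scalars move past the left factors \<beta> and
    \<open>\<sigma> x\<close>.\<close>
  have scale_mult_right: "scale r (x * y) = x * scale r y" for r x y
    by (metis mult.commute scale_mult_left)
  have "module_hom scale scale (\<lambda>x. \<beta> * \<tau> x - \<sigma> x * \<beta>)"
    by unfold_locales
      (simp_all add: s.add t.add s.scale t.scale scale_right_diff_distrib
        scale_mult_right[symmetric] scale_mult_left[symmetric] algebra_simps)
  then show ?thesis
    using \<sigma> \<tau> by (simp add: twisted_derivation_def algebra_endomorphism_def algebra_simps)
qed

lemma twisted_derivation_one:
  assumes "twisted_derivation scale \<sigma> \<tau> D" and "\<sigma> 1 = 1" and "\<tau> 1 = 1"
  shows "D 1 = 0"
proof -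
  \<comment> \<open>This reads \<open>D 1 = D 1 + D 1\<close>, so one summand cancels.\<close>
  have "D (1 * 1) = D 1 * \<tau> 1 + \<sigma> 1 * D 1"
    using assms(1) unfolding twisted_derivation_def by blast
  then show ?thesis using assms(2,3) by simp
qed

text \<open>Leibniz on \<open>\<alpha> * \<alpha> ^ i\<close> gives a recursion for the values on
  powers whose coefficients \<open>\<tau> (\<alpha> ^ i)\<close> and
  \<open>\<sigma> \<alpha>\<close> are the same for \<open>D\<close> and \<open>E\<close>.\<close>

lemma twisted_derivation_eq_on_powers:
  assumes D: "twisted_derivation scale \<sigma> \<tau> D" and E: "twisted_derivation scale \<sigma> \<tau> E"
    and one: "\<sigma> 1 = 1" "\<tau> 1 = 1" and gen: "D \<alpha> = E \<alpha>"
  shows "D (\<alpha> ^ i) = E (\<alpha> ^ i)"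
proof (induction i)
  case 0
  then show ?case
    using twisted_derivation_one[OF D one] twisted_derivation_one[OF E one] by simp
next
  case (Suc i)
  then show ?case
    using D E gen by (simp add: twisted_derivation_def)
qed

theorem theorem2p29:
  fixes scale :: "'r::comm_ring_1 \<Rightarrow> 'a::comm_ring_1 \<Rightarrow> 'a"
    and \<sigma> \<tau> D :: "'a \<Rightarrow> 'a" and \<alpha> :: 'a and n :: nat
  assumes "comm_algebra scale"
    and "algebra_endomorphism scale \<sigma>" and "algebra_endomorphism scale \<tau>"
    and "\<sigma> \<noteq> (\<lambda>_. 0)" and "\<tau> \<noteq> (\<lambda>_. 0)" and "\<sigma> \<noteq> \<tau>"
    and "has_finite_rank scale n"
    and "inj_on (\<lambda>i. \<alpha> ^ i) {..<n}"
    and "module_basis scale ((\<lambda>i. \<alpha> ^ i) ` {..<n})"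
    and "twisted_derivation scale \<sigma> \<tau> D"
  shows "inner_twisted \<sigma> \<tau> D \<longleftrightarrow> (\<exists>\<beta>. D \<alpha> = \<beta> * (\<tau> \<alpha> - \<sigma> \<alpha>))"
proof
  assume "inner_twisted \<sigma> \<tau> D"
  then obtain \<beta> where "\<forall>x. D x = \<beta> * \<tau> x - \<sigma> x * \<beta>"
    unfolding inner_twisted_def by blast
  \<comment> \<open>Commutativity moves \<beta> to the left of
    \<open>\<sigma> \<alpha>\<close>.\<close>
  then have "D \<alpha> = \<beta> * (\<tau> \<alpha> - \<sigma> \<alpha>)"
    by (simp add: algebra_simps)
  then show "\<exists>\<beta>. D \<alpha> = \<beta> * (\<tau> \<alpha> - \<sigma> \<alpha>)" ..
next
  assume "\<exists>\<beta>. D \<alpha> = \<beta> * (\<tau> \<alpha> - \<sigma> \<alpha>)"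
  then obtain \<beta> where \<beta>: "D \<alpha> = \<beta> * (\<tau> \<alpha> - \<sigma> \<alpha>)" ..
  \<comment> \<open>The inner derivation with the given \<beta>, built to match \<open>D\<close> at
    \<alpha>; the goal becomes \<open>D = E\<close>.\<close>
  define E where "E x = \<beta> * \<tau> x - \<sigma> x * \<beta>" for x
  have E: "twisted_derivation scale \<sigma> \<tau> E"
    using twisted_derivation_inner[OF assms(1-3)] by (simp add: E_def[abs_def])
  interpret comm_algebra scale by fact
  interpret module_pair scale scale ..
  have "D \<alpha> = E \<alpha>"
    using \<beta> by (simp add: E_def algebra_simps)
  moreover have "\<sigma> 1 = 1" "\<tau> 1 = 1"
    using assms(2,3) by (simp_all add: algebra_endomorphism_def)
  ultimately have powers: "D (\<alpha> ^ i) = E (\<alpha> ^ i)" for i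
    using twisted_derivation_eq_on_powers[OF assms(10) E] by blast
  have "module_hom scale scale D" "module_hom scale scale E"
    using assms(10) E by (simp_all add: twisted_derivation_def)
  moreover have "D y = E y" if "y \<in> (\<lambda>i. \<alpha> ^ i) ` {..<n}" for y
    using that powers by blast
  moreover have "x \<in> span ((\<lambda>i. \<alpha> ^ i) ` {..<n})" for x
    using assms(9) by (simp add: module_basis_def)
  ultimately have "D x = E x" for x
    by (rule module_hom_eq_on_span)
  then show "inner_twisted \<sigma> \<tau> D"
    unfolding inner_twisted_def E_def by blast
qed

end
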